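(* Let $N > 1$ be an integer, let $\xi \in \mathbb{C}$ satisfy $\xi^N = 1$, and let $n \ge 1$ be an integer. The $n$-th Frobenius-Schur indicator $\nu_n(H)$ of the regular representation of $H = H_{2N^2}(\xi)$ is given as follows. If either $n$ is odd or the condition \[ b_2(N) = b_2(\mathrm{ord}(\xi)) = b_2(n) - 1 \ge 1 \] holds, then $\nu_n(H) = \gcd(N, n)^2$. Otherwise, $\nu_n(H) = \gcd(N, n)^2 + N \gcd(N, n/2)$.
   Context: For a prime $p$ and a positive integer $m$, $b_p(m)$ is the largest integer $i \ge 0$ such that $p^i$ divides $m$. $\mathrm{ord}(\xi)$ is the multiplicative order of $\xi$. The Hopf algebra $H_{2N^2}(\xi)$ (Masuoka), of dimension $2N^2$ over $\mathbb{C}$: let $F = \mathbb{Z}_2$ act on the right on $G = \mathbb{Z}_N \times \mathbb{Z}_N$ by exchanging the two coordinates, and let $G$ act trivially on $F$. Let $e_{ij}$ ($i,j \in \mathbb{Z}_N$) be the basis of $\mathbb{C}^G$ dual to the elements $(i,j) \in G$. Then $H_{2N^2}(\xi) = \mathbb{C}^G \#_{\sigma,\tau} \mathbb{C}F$, where $\sigma((i,j);a,b) = \xi^{ij}$ if $a=b=1$ and $1$ otherwise, and $\tau((i,j),(k,l);a) = \xi^{jk}$ if $a=1$ and $1$ otherwise. Explicitly, it is the algebra generated by $\mathbb{C}^G$ and an element $u$ with relations $u^2 = \sum_{i,j} \xi^{ij} e_{ij}$ and $u e_{ij} = e_{ji} u$ (basis $e_{ij}, e_{ij}u$), with $\Delta(e_{ij})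 = \sum_{p,q} e_{i-p,j-q} \otimes e_{pq}$, $\Delta(u) = \sum_{i,j,k,l} \xi^{jk} e_{ij} u \otimes e_{kl} u$, $\varepsilon(e_{ij}) = \delta_{i0}\delta_{j0}$, $\varepsilon(u) = 1$. It is semisimple. For a finite-dimensional semisimple Hopf algebra $H$ over $\mathbb{C}$, $\nu_n(H) = \chi_H(\Lambda_{(1)} \Lambda_{(2)} \cdots \Lambda_{(n)})$, where $\Lambda \in H$ is the integral with $\varepsilon(\Lambda) = 1$, Sweedler notation is used for the iterated comultiplication, and $\chi_H$ is the character of the (left) regular representation. *)

theory Defs
  imports Complex_Main "HOL-Computational_Algebra.Primes"
begin

section \<open>Finite-dimensional Hopf algebras given by structure constants\<close>

text \<open>
  A finite-dimensional complex Hopf algebra is presented on a finite basis by its structure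
  constants: for basis elements \<open>a\<close>, \<open>b\<close>, \<open>c\<close>, \<open>d\<close>,
  \<^item> \<open>mul_coeff H a b c\<close> is the coefficient of \<open>c\<close> in the product \<open>a b\<close>,
  \<^item> \<open>unit_coeff H c\<close> is the coefficient of \<open>c\<close> in the unit,
  \<^item> \<open>comul_coeff H b c d\<close> is the coefficient of \<open>c \<otimes> d\<close> in \<open>\<Delta>(b)\<close>,
  \<^item> \<open>counit_coeff H b\<close> is \<open>\<epsilon>(b)\<close>.

  The antipode is not recorded: it is uniquely determined by the other data, and neither
  integrals nor Frobenius-Schur indicators refer to it.
\<close>

record 'b hopf_data =
  basis :: "'b set"
  mul_coeff :: "'b \<Rightarrow> 'b \<Rightarrow> 'b \<Rightarrow> complex"
  unit_coeff :: "'b \<Rightarrow> complex"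
  comul_coeff :: "'b \<Rightarrow> 'b \<Rightarrow> 'b \<Rightarrow> complex"
  counit_coeff :: "'b \<Rightarrow> complex"

text \<open>
  Elements of the algebra are coordinate functions vanishing off the basis; elements of its
  \<open>n\<close>-th tensor power are coordinate functions on lists of \<open>n\<close> basis elements.
\<close>

definition elements :: "'b hopf_data \<Rightarrow> ('b \<Rightarrow> complex) set" where
  "elements H = {x. \<forall>b. b \<notin> basis H \<longrightarrow> x b = 0}"

definition basis_vec :: "'b \<Rightarrow> 'b \<Rightarrow> complex" where
  "basis_vec b = (\<lambda>c. if c = b then 1 else 0)"

definition mul :: "'b hopf_data \<Rightarrow> ('b \<Rightarrow> complex) \<Rightarrow> ('b \<Rightarrow> complex) \<Rightarrow> 'b \<Rightarrow> complex" where
  "mul H x y = (\<lambda>c. \<Sum>a\<in>basis H. \<Sum>b\<in>basis H. x a * y b * mul_coeff H a b c)"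

definition counit :: "'b hopf_data \<Rightarrow> ('b \<Rightarrow> complex) \<Rightarrow> complex" where
  "counit H x = (\<Sum>b\<in>basis H. x b * counit_coeff H b)"

definition comul :: "'b hopf_data \<Rightarrow> ('b \<Rightarrow> complex) \<Rightarrow> 'b \<Rightarrow> 'b \<Rightarrow> complex" where
  "comul H x = (\<lambda>c d. \<Sum>b\<in>basis H. x b * comul_coeff H b c d)"

text \<open>
  The iterated comultiplication into the \<open>n\<close>-th tensor power,
  \<open>x \<mapsto> x\<^sub>(\<^sub>1\<^sub>) \<otimes> \<dots> \<otimes> x\<^sub>(\<^sub>n\<^sub>)\<close>, by \<open>\<Delta>\<^sup>(\<^sup>1\<^sup>) = id\<close> and
  \<open>\<Delta>\<^sup>(\<^sup>n\<^sup>+\<^sup>1\<^sup>) = (id \<otimes> \<Delta>\<^sup>(\<^sup>n\<^sup>)) \<circ> \<Delta>\<close>; by convention \<open>\<Delta>\<^sup>(\<^sup>0\<^sup>) = \<epsilon>\<close>.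
\<close>

fun iter_comul :: "'b hopf_data \<Rightarrow> nat \<Rightarrow> ('b \<Rightarrow> complex) \<Rightarrow> 'b list \<Rightarrow> complex" where
  "iter_comul H 0 x cs = (case cs of [] \<Rightarrow> counit H x | _ \<Rightarrow> 0)"
| "iter_comul H (Suc 0) x cs = (case cs of [c] \<Rightarrow> x c | _ \<Rightarrow> 0)"
| "iter_comul H (Suc (Suc n)) x cs =
     (case cs of [] \<Rightarrow> 0
      | c # ds \<Rightarrow> \<Sum>d\<in>basis H. comul H x c d * iter_comul H (Suc n) (basis_vec d) ds)"

text \<open>The linear extension of \<open>b\<^sub>1 \<otimes> \<dots> \<otimes> b\<^sub>n \<mapsto> b\<^sub>1 \<cdots> b\<^sub>n\<close>.\<close>

definition tensor_mul :: "'b hopf_data \<Rightarrow> nat \<Rightarrow> ('b list \<Rightarrow> complex) \<Rightarrow> 'b \<Rightarrow> complex" where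
  "tensor_mul H n T = (\<lambda>c. \<Sum>bs\<in>{bs. set bs \<subseteq> basis H \<and> length bs = n}.
     T bs * foldr (\<lambda>b y. mul H (basis_vec b) y) bs (unit_coeff H) c)"

definition sweedler_power :: "'b hopf_data \<Rightarrow> nat \<Rightarrow> ('b \<Rightarrow> complex) \<Rightarrow> 'b \<Rightarrow> complex" where
  "sweedler_power H n x = tensor_mul H n (iter_comul H n x)"

definition regular_character :: "'b hopf_data \<Rightarrow> ('b \<Rightarrow> complex) \<Rightarrow> complex" where
  "regular_character H x = (\<Sum>b\<in>basis H. mul H x (basis_vec b) b)"

definition is_integral :: "'b hopf_data \<Rightarrow> ('b \<Rightarrow> complex) \<Rightarrow> bool" where
  "is_integral H L \<longleftrightarrow> L \<in> elements H \<and>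
     (\<forall>h\<in>elements H. mul H h L = (\<lambda>b. counit H h * L b) \<and>
                      mul H L h = (\<lambda>b. counit H h * L b))"

definition normalized_integral :: "'b hopf_data \<Rightarrow> 'b \<Rightarrow> complex" where
  "normalized_integral H = (THE L. is_integral H L \<and> counit H L = 1)"

definition fs_indicator :: "nat \<Rightarrow> 'b hopf_data \<Rightarrow> complex" where
  "fs_indicator n H = regular_character H (sweedler_power H n (normalized_integral H))"


section \<open>Masuoka's Hopf algebra of dimension \<open>2N\<^sup>2\<close>\<close>

text \<open>
  Residues modulo \<open>N\<close> and modulo \<open>2\<close> are represented by their least non-negative
  representatives; since \<open>\<xi> ^ N = 1\<close> is assumed, the powers of \<open>\<xi>\<close> below do not depend
  on this choice. The basis element \<open>((i, j), a)\<close> stands for \<open>e\<^sub>i\<^sub>j u\<^sup>a\<close>.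
\<close>

definition swap_act :: "nat \<times> nat \<Rightarrow> nat \<Rightarrow> nat \<times> nat" where
  "swap_act s a = (if a = 1 then (snd s, fst s) else s)"

definition masuoka_sigma :: "complex \<Rightarrow> nat \<times> nat \<Rightarrow> nat \<Rightarrow> nat \<Rightarrow> complex" where
  "masuoka_sigma \<xi> s a b = (if a = 1 \<and> b = 1 then \<xi> ^ (fst s * snd s) else 1)"

definition masuoka_tau :: "complex \<Rightarrow> nat \<times> nat \<Rightarrow> nat \<times> nat \<Rightarrow> nat \<Rightarrow> complex" where
  "masuoka_tau \<xi> s t a = (if a = 1 then \<xi> ^ (snd s * fst t) else 1)"

text \<open>
  With \<open>s \<triangleleft> a\<close> the action by exchange of coordinates, the bicrossed product has
  \<open>(e\<^sub>s u\<^sup>a) (e\<^sub>t u\<^sup>b) = \<delta>\<^bsub>s \<triangleleft> a, t\<^esub> \<sigma>(s; a, b) e\<^sub>s u\<^sup>a\<^sup>+\<^sup>b\<close>, exponents of \<open>u\<close> on the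
  right being read modulo \<open>2\<close>, and
  \<open>\<Delta>(e\<^sub>r u\<^sup>a) = \<Sum>\<^bsub>r = s + t\<^esub> \<tau>(s, t; a) e\<^sub>s u\<^sup>a \<otimes> e\<^sub>t u\<^sup>a\<close>.
  Setting \<open>u = \<Sum>\<^sub>s e\<^sub>s u\<close>, this amounts to \<open>u e\<^sub>i\<^sub>j = e\<^sub>j\<^sub>i u\<close>,
  \<open>u\<^sup>2 = \<Sum>\<^sub>i\<^sub>j \<xi>\<^sup>i\<^sup>j e\<^sub>i\<^sub>j\<close> and \<open>\<Delta>(u) = \<Sum> \<xi>\<^sup>j\<^sup>k e\<^sub>i\<^sub>j u \<otimes> e\<^sub>k\<^sub>l u\<close>.
\<close>

definition masuoka_hopf :: "nat \<Rightarrow> complex \<Rightarrow> ((nat \<times> nat) \<times> nat) hopf_data" where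
  "masuoka_hopf N \<xi> =
     \<lparr> basis = ({..<N} \<times> {..<N}) \<times> {..<2},
       mul_coeff = (\<lambda>(s, a) (t, b) (r, c).
         if swap_act s a = t \<and> r = s \<and> c = (a + b) mod 2 then masuoka_sigma \<xi> s a b else 0),
       unit_coeff = (\<lambda>(s, a).
         if s \<in> {..<N} \<times> {..<N} \<and> a = 0 then 1 else 0),
       comul_coeff = (\<lambda>(r, a) (s, b) (t, c).
         if s \<in> {..<N} \<times> {..<N} \<and> t \<in> {..<N} \<times> {..<N}
            \<and> r = ((fst s + fst t) mod N, (snd s + snd t) mod N) \<and> b = a \<and> c = a
         then masuoka_tau \<xi> s t a else 0),
       counit_coeff = (\<lambda>(s, a). if s = (0, 0) then 1 else 0) \<rparr>"

definition mult_order :: "complex \<Rightarrow> nat" where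
  "mult_order \<xi> = (LEAST d. d > 0 \<and> \<xi> ^ d = 1)"

end

theory Submission
  imports Defs "HOL-Number_Theory.Cong"
begin

text \<open>
  The normalized integral is \<open>(e\<^sub>0\<^sub>0 + e\<^sub>0\<^sub>0 u) / 2\<close>. The Sweedler power of \<open>e\<^sub>0\<^sub>0\<close> is
  the sum of the \<open>e\<^sub>s\<close> with \<open>n s = 0\<close>, which yields \<open>gcd(N, n)\<^sup>2\<close>. In the Sweedler power of
  \<open>e\<^sub>0\<^sub>0 u\<close> only the products \<open>e\<^sub>s u e\<^sub>s\<^sub>' u e\<^sub>s u \<dots>\<close> survive, where \<open>s = (i, j)\<close> and
  \<open>s' = (j, i)\<close>; they have trace zero if \<open>n\<close> is odd. If \<open>n = 2 m\<close>, the indices add up to zero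
  exactly when \<open>m (i + j) = 0\<close>, and modulo this constraint the accumulated power of \<open>\<xi>\<close> has exponent
  \<open>(m choose 2) (i + j)\<^sup>2\<close>. This leaves \<open>N\<close> times a quadratic sum over the \<open>t\<close> modulo \<open>N\<close> with
  \<open>m t = 0\<close>. All its terms are \<open>1\<close>, unless \<open>m\<close> is even, \<open>N\<close> and \<open>m\<close> have the same \<open>2\<close>-adic
  valuation and \<open>\<xi>\<^bsup>N/2\<^esup> = -1\<close>; then the terms alternate in sign and cancel.
\<close>

section \<open>Sweedler powers in terms of structure constants\<close>

lemma sum_lists_Suc:
  "(\<Sum>bs\<in>{bs. set bs \<subseteq> A \<and> length bs = Suc n}. f bs) =
    (\<Sum>c\<in>A. \<Sum>ds\<in>{ds. set ds \<subseteq> A \<and> length ds = n}. f (c # ds))"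
proof -
  have "inj_on (\<lambda>(ds, c). c # ds) ({ds. set ds \<subseteq> A \<and> length ds = n} \<times> A)"
    by (auto simp: inj_on_def)
  then have "(\<Sum>bs\<in>{bs. set bs \<subseteq> A \<and> length bs = Suc n}. f bs) =
      (\<Sum>(ds, c)\<in>{ds. set ds \<subseteq> A \<and> length ds = n} \<times> A. f (c # ds))"
    unfolding lists_length_Suc_eq by (simp add: sum.reindex case_prod_unfold)
  also have "\<dots> = (\<Sum>c\<in>A. \<Sum>ds\<in>{ds. set ds \<subseteq> A \<and> length ds = n}. f (c # ds))"
    by (subst sum.swap) (simp add: sum.cartesian_product)
  finally show ?thesis .
qed

lemma mul_basis_vec_left:
  assumes "finite (basis H)" "p \<in> basis H"
  shows "mul H (basis_vec p) y q = (\<Sum>b\<in>basis H. y b * mul_coeff H p b q)"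
proof -
  have "mul H (basis_vec p) y q =
      (\<Sum>a\<in>basis H. if a = p then \<Sum>b\<in>basis H. y b * mul_coeff H a b q else 0)"
    unfolding mul_def by (intro sum.cong refl) (simp add: basis_vec_def)
  then show ?thesis
    using assms by simp
qed

lemma mul_expand_left:
  assumes "finite (basis H)"
  shows "mul H x y q = (\<Sum>p\<in>basis H. x p * mul H (basis_vec p) y q)"
  unfolding mul_def[of _ x]
  by (intro sum.cong refl) (simp add: mul_basis_vec_left assms sum_distrib_left mult.assoc)

lemma mul_sum_right:
  "mul H x (\<lambda>c. \<Sum>i\<in>I. k i * y i c) c = (\<Sum>i\<in>I. k i * mul H x (y i) c)"
proof -
  have "mul H x (\<lambda>c. \<Sum>i\<in>I. k i * y i c) c =
      (\<Sum>a\<in>basis H. \<Sum>b\<in>basis H. \<Sum>i\<in>I. k i * (x a * y i b * mul_coeff H a b c))"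
    by (simp add: mul_def sum_distrib_left sum_distrib_right algebra_simps)
  also have "\<dots> = (\<Sum>a\<in>basis H. \<Sum>i\<in>I. \<Sum>b\<in>basis H. k i * (x a * y i b * mul_coeff H a b c))"
    by (intro sum.cong refl sum.swap)
  also have "\<dots> = (\<Sum>i\<in>I. \<Sum>a\<in>basis H. \<Sum>b\<in>basis H. k i * (x a * y i b * mul_coeff H a b c))"
    by (rule sum.swap)
  finally show ?thesis
    by (simp add: mul_def sum_distrib_left)
qed

lemma sweedler_power_1:
  "sweedler_power H (Suc 0) x c = (\<Sum>b\<in>basis H. x b * mul H (basis_vec b) (unit_coeff H) c)"
proof -
  have *: "{ds. set ds \<subseteq> basis H \<and> length ds = 0} = {[]}"
    by auto
  show ?thesis
    unfolding sweedler_power_def tensor_mul_def sum_lists_Suc * by simp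
qed

text \<open>Both \<open>iter_comul\<close> and the \<open>foldr\<close> in \<open>tensor_mul\<close>
  split off the head of the list, and multiplication is linear in its second argument. The recursion
  replaces sums over lists in all later computations.\<close>

lemma sweedler_power_Suc:
  "sweedler_power H (Suc (Suc n)) x e =
    (\<Sum>c\<in>basis H. \<Sum>d\<in>basis H.
      comul H x c d * mul H (basis_vec c) (sweedler_power H (Suc n) (basis_vec d)) e)"
proof -
  define L where "L = {ds. set ds \<subseteq> basis H \<and> length ds = Suc n}"
  define F where "F ds = foldr (\<lambda>b y. mul H (basis_vec b) y) ds (unit_coeff H)" for ds
  define T where "T d = iter_comul H (Suc n) (basis_vec d)" for d
  have P: "sweedler_power H (Suc n) (basis_vec d) = (\<lambda>c. \<Sum>ds\<in>L. T d ds * F ds c)" for d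
    by (simp add: sweedler_power_def tensor_mul_def L_def F_def T_def)
  have "sweedler_power H (Suc (Suc n)) x e =
      (\<Sum>c\<in>basis H. \<Sum>ds\<in>L. (\<Sum>d\<in>basis H. comul H x c d * T d ds) * mul H (basis_vec c) (F ds) e)"
    unfolding sweedler_power_def tensor_mul_def sum_lists_Suc[where n = "Suc n"]
    by (simp add: L_def F_def T_def)
  also have "\<dots> = (\<Sum>c\<in>basis H. \<Sum>d\<in>basis H. \<Sum>ds\<in>L.
      comul H x c d * (T d ds * mul H (basis_vec c) (F ds) e))"
    by (simp add: sum_distrib_right mult.assoc) (intro sum.cong refl sum.swap)
  also have "\<dots> = (\<Sum>c\<in>basis H. \<Sum>d\<in>basis H.
      comul H x c d * mul H (basis_vec c) (sweedler_power H (Suc n) (basis_vec d)) e)"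
    by (simp add: P mul_sum_right sum_distrib_left)
  finally show ?thesis .
qed

text \<open>Uniqueness: for normalized integrals \<open>L\<close> and \<open>L'\<close> the product
  \<open>mul H L' L\<close> equals \<open>L\<close> because \<open>L\<close> is a left integral, and
  \<open>L'\<close> because \<open>L'\<close> is a right integral.\<close>

lemma normalized_integral_eqI:
  assumes "is_integral H L" and "counit H L = 1"
  shows "normalized_integral H = L"
  unfolding normalized_integral_def
proof (rule the_equality)
  show "is_integral H L \<and> counit H L = 1"
    using assms by simp
next
  fix L' assume L': "is_integral H L' \<and> counit H L' = 1"
  then have "mul H L' L = L"
    using assms by (auto simp: is_integral_def)
  moreover have "mul H L' L = L'"
    using L' assms by (auto simp: is_integral_def)
  ultimately show "L' = L"
    by simp
qed

section \<open>Masuoka's algebra in coordinates\<close>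

definition residue_pairs :: "nat \<Rightarrow> (nat \<times> nat) set" where
  "residue_pairs N = {..<N} \<times> {..<N}"

lemma finite_residue_pairs [simp]: "finite (residue_pairs N)"
  by (simp add: residue_pairs_def)

lemma basis_masuoka: "basis (masuoka_hopf N \<xi>) = residue_pairs N \<times> {..<2}"
  by (simp add: masuoka_hopf_def residue_pairs_def)

lemma swap_act_in_residue_pairs [simp]:
  "swap_act s a \<in> residue_pairs N \<longleftrightarrow> s \<in> residue_pairs N"
  by (cases s) (auto simp: swap_act_def residue_pairs_def)

lemma swap_act_simps [simp]: "swap_act s 0 = s" "swap_act s (Suc 0) = (snd s, fst s)"
  by (simp_all add: swap_act_def)

lemma masuoka_sigma_0 [simp]: "masuoka_sigma \<xi> s 0 b = 1" "masuoka_sigma \<xi> s a 0 = 1"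
  by (simp_all add: masuoka_sigma_def)

lemma sum_lessThan_2: "(\<Sum>a<2::nat. f a) = f 0 + f (Suc 0)"
  by (simp add: numeral_2_eq_2)

lemma mul_masuoka_basis_vec:
  assumes "s \<in> residue_pairs N" "a < 2" "r \<in> residue_pairs N" "b < 2"
  shows "mul (masuoka_hopf N \<xi>) (basis_vec (s, a)) y (r, b) =
    (if s = r then y (swap_act s a, (a + b) mod 2) * masuoka_sigma \<xi> s a ((a + b) mod 2) else 0)"
proof -
  let ?H = "masuoka_hopf N \<xi>"
  have c: "mul_coeff ?H (s, a) tb (r, b) =
      (if tb = (swap_act s a, (a + b) mod 2) \<and> s = r
       then masuoka_sigma \<xi> s a ((a + b) mod 2) else 0)"
    if "tb \<in> basis ?H" for tb
  proof (cases tb)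
    case (Pair t b')
    then have "b' < 2" using that by (simp add: basis_masuoka)
    \<comment> \<open>Modulo 2, subtracting \<open>a\<close> is the same as adding it; this solves
      \<open>b = (a + b') mod 2\<close> for \<open>b'\<close>.\<close>
    then have "b' = (a + b) mod 2 \<longleftrightarrow> b = (a + b') mod 2"
      using assms by (auto simp: less_2_cases_iff)
    with Pair show ?thesis
      by (auto simp: masuoka_hopf_def)
  qed
  have "mul ?H (basis_vec (s, a)) y (r, b) = (\<Sum>tb\<in>basis ?H. y tb * mul_coeff ?H (s, a) tb (r, b))"
    using assms by (intro mul_basis_vec_left) (simp_all add: basis_masuoka)
  also have "\<dots> = (\<Sum>tb\<in>basis ?H. if tb = (swap_act s a, (a + b) mod 2)
      then if s = r then y tb * masuoka_sigma \<xi> s a ((a + b) mod 2) else 0 else 0)"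
    by (intro sum.cong refl) (simp add: c)
  also have "\<dots> = (if s = r then y (swap_act s a, (a + b) mod 2) *
      masuoka_sigma \<xi> s a ((a + b) mod 2) else 0)"
    using assms by (simp add: basis_masuoka)
  finally show ?thesis .
qed

definition add_mod :: "nat \<Rightarrow> nat \<times> nat \<Rightarrow> nat \<times> nat \<Rightarrow> nat \<times> nat" where
  "add_mod N s t = ((fst s + fst t) mod N, (snd s + snd t) mod N)"

lemma comul_masuoka:
  assumes "s \<in> residue_pairs N" "a < 2" "t \<in> residue_pairs N" "b < 2"
  shows "comul (masuoka_hopf N \<xi>) x (s, a) (t, b) =
    (if b = a then x (add_mod N s t, a) * masuoka_tau \<xi> s t a else 0)"
proof -
  let ?H = "masuoka_hopf N \<xi>"
  have "comul_coeff ?H r (s, a) (t, b) =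
      (if r = (add_mod N s t, a) then if b = a then masuoka_tau \<xi> s t a else 0 else 0)" for r
    using assms by (cases r) (auto simp: masuoka_hopf_def add_mod_def residue_pairs_def)
  then have "comul ?H x (s, a) (t, b) =
      (\<Sum>r\<in>basis ?H. if r = (add_mod N s t, a)
        then if b = a then x r * masuoka_tau \<xi> s t a else 0 else 0)"
    unfolding comul_def by (intro sum.cong) auto
  then show ?thesis
    using assms by (auto simp: basis_masuoka) (auto simp: residue_pairs_def add_mod_def)
qed

lemma sweedler_power_masuoka_1:
  assumes "s \<in> residue_pairs N" "b < 2"
  shows "sweedler_power (masuoka_hopf N \<xi>) (Suc 0) x (s, b) = x (s, b)"
proof -
  let ?H = "masuoka_hopf N \<xi>"
  have u: "unit_coeff ?H (t, c) = (if t \<in> residue_pairs N \<and> c = 0 then 1 else 0)" for t c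
    by (simp add: masuoka_hopf_def residue_pairs_def)
  have "mul ?H (basis_vec r) (unit_coeff ?H) (s, b) = (if r = (s, b) then 1 else 0)"
    if "r \<in> basis ?H" for r
    using that assms by (cases r) (auto simp: basis_masuoka mul_masuoka_basis_vec u less_2_cases_iff)
  then have "sweedler_power ?H (Suc 0) x (s, b) =
      (\<Sum>r\<in>basis ?H. if r = (s, b) then x r else 0)"
    unfolding sweedler_power_1 by (intro sum.cong) auto
  then show ?thesis
    using assms by (simp add: basis_masuoka)
qed

text \<open>Comultiplication gives both tensor factors the same power of \<open>u\<close>, and a
  product with left factor at index \<open>r\<close> lives at index \<open>r\<close>. So two of the
  four sums in the general recursion collapse.\<close>

lemma sweedler_power_masuoka_Suc:
  assumes "s \<in> residue_pairs N" "b < 2"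
  shows "sweedler_power (masuoka_hopf N \<xi>) (Suc (Suc n)) x (s, b) =
    (\<Sum>a<2. \<Sum>t\<in>residue_pairs N.
      x (add_mod N s t, a) * masuoka_tau \<xi> s t a * masuoka_sigma \<xi> s a ((a + b) mod 2) *
      sweedler_power (masuoka_hopf N \<xi>) (Suc n) (basis_vec (t, a)) (swap_act s a, (a + b) mod 2))"
proof -
  let ?H = "masuoka_hopf N \<xi>"
  define f where "f a t = x (add_mod N s t, a) * masuoka_tau \<xi> s t a *
    masuoka_sigma \<xi> s a ((a + b) mod 2) *
    sweedler_power ?H (Suc n) (basis_vec (t, a)) (swap_act s a, (a + b) mod 2)" for a t
  have "sweedler_power ?H (Suc (Suc n)) x (s, b) =
      (\<Sum>r\<in>residue_pairs N. \<Sum>a<2. \<Sum>t\<in>residue_pairs N. \<Sum>c<2.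
        comul ?H x (r, a) (t, c) *
        mul ?H (basis_vec (r, a)) (sweedler_power ?H (Suc n) (basis_vec (t, c))) (s, b))"
    by (simp add: sweedler_power_Suc basis_masuoka sum.cartesian_product' case_prod_unfold)
  also have "\<dots> = (\<Sum>r\<in>residue_pairs N. \<Sum>a<2. \<Sum>t\<in>residue_pairs N. \<Sum>c<2.
      if c = a then if r = s then f a t else 0 else 0)"
    using assms
    by (intro sum.cong refl) (auto simp: comul_masuoka mul_masuoka_basis_vec f_def)
  also have "\<dots> = (\<Sum>r\<in>residue_pairs N. if r = s then \<Sum>a<2. \<Sum>t\<in>residue_pairs N. f a t else 0)"
    by (intro sum.cong refl) auto
  also have "\<dots> = (\<Sum>a<2. \<Sum>t\<in>residue_pairs N. f a t)"
    using assms by simp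
  finally show ?thesis
    by (simp add: f_def)
qed

section \<open>Sweedler powers in Masuoka's algebra\<close>

lemma root_of_unity_power_mod:
  fixes \<xi> :: complex
  assumes "\<xi> ^ N = 1"
  shows "\<xi> ^ (k mod N) = \<xi> ^ k"
proof -
  have "\<xi> ^ k = \<xi> ^ (N * (k div N) + k mod N)"
    by simp
  also have "\<dots> = \<xi> ^ (k mod N)"
    by (simp only: power_add power_mult assms power_one mult_1_left)
  finally show ?thesis
    by simp
qed

lemma root_of_unity_power_cong:
  fixes \<xi> :: complex
  assumes "\<xi> ^ N = 1" "[j = k] (mod N)"
  shows "\<xi> ^ j = \<xi> ^ k"
  using assms root_of_unity_power_mod[OF assms(1)] by (metis cong_def)

text \<open>
  For the product \<open>e\<^sub>s u e\<^sub>s\<^sub>' u e\<^sub>s u \<dots>\<close> of \<open>n\<close> factors, with \<open>s'\<close> the exchange of \<open>s\<close>,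
  \<open>twist_sum n s\<close> is the sum of the indices and \<open>twist_exponent n s\<close> is the exponent of \<open>\<xi>\<close>
  contributed by the cocycles: by \<open>\<tau>\<close> when the first tensor factor is split off, and by
  \<open>\<sigma>\<close> when it is multiplied to a product containing an odd number of \<open>u\<close>. Both are kept in
  \<open>nat\<close>, without reduction modulo \<open>N\<close>.
\<close>

fun twist_sum :: "nat \<Rightarrow> nat \<times> nat \<Rightarrow> nat \<times> nat" where
  "twist_sum 0 s = (0, 0)"
| "twist_sum (Suc n) s =
    (fst s + fst (twist_sum n (snd s, fst s)), snd s + snd (twist_sum n (snd s, fst s)))"

fun twist_exponent :: "nat \<Rightarrow> nat \<times> nat \<Rightarrow> nat" where
  "twist_exponent 0 s = 0"
| "twist_exponent (Suc n) s =
    snd s * fst (twist_sum n (snd s, fst s)) + twist_exponent n (snd s, fst s) +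
    (if odd n then fst s * snd s else 0)"

lemma twist_sum_even: "twist_sum (2 * m) (i, j) = (m * (i + j), m * (i + j))"
  by (induction m) (auto simp: algebra_simps)

text \<open>Two steps of the recursion restore the order of the coordinates and add
  \<open>m * (i + j)\<^sup>2 + (i + j) * j\<close> to the exponent for \<open>2 * m\<close>; the
  factors \<open>0, 1, ..., m - 1\<close> sum to the binomial coefficient. The last summand is kept
  apart because it vanishes modulo \<open>N\<close> when \<open>N dvd m * (i + j)\<close>.\<close>

lemma twist_exponent_even:
  "twist_exponent (2 * m) (i, j) = (m choose 2) * (i + j)\<^sup>2 + m * (i + j) * j"
proof (induction m)
  case (Suc m)
  have "Suc m choose 2 = m + (m choose 2)"
    by (simp add: numeral_2_eq_2)
  moreover have "twist_sum (m * 2) (i, j) = (m * (i + j), m * (i + j))"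
    using twist_sum_even[of m] by (simp only: mult.commute)
  ultimately show ?case
    using Suc by (simp add: algebra_simps power2_eq_square)
qed simp

text \<open>All tensor factors carry the same power of \<open>u\<close>, either 0 or 1, which gives
  the two summands. In the induction step the hypothesis, applied to basis vectors, reduces each sum
  over \<open>t\<close> to one term.\<close>

lemma sweedler_power_masuoka:
  assumes xi: "\<xi> ^ N = 1" and "s \<in> residue_pairs N" "b < 2"
  shows "sweedler_power (masuoka_hopf N \<xi>) (Suc n) x (s, b) =
    (if b = 0 then x ((Suc n * fst s mod N, Suc n * snd s mod N), 0) else 0) +
    (if b = Suc n mod 2
     then \<xi> ^ twist_exponent (Suc n) s *
       x ((fst (twist_sum (Suc n) s) mod N, snd (twist_sum (Suc n) s) mod N), 1)
     else 0)"
  using assms(2,3)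
proof (induction n arbitrary: x s b)
  case 0
  then show ?case
    by (cases s) (auto simp: sweedler_power_masuoka_1 residue_pairs_def less_2_cases_iff)
next
  case (Suc n)
  let ?H = "masuoka_hopf N \<xi>"
  let ?R = "residue_pairs N"
  obtain i j where s: "s = (i, j)" by (cases s)
  have N: "0 < N" using Suc.prems by (auto simp: residue_pairs_def)
  let ?P = "\<lambda>a t. sweedler_power ?H (Suc n) (basis_vec (t, a)) (swap_act s a, (a + b) mod 2)"
  \<comment> \<open>\<open>t0\<close> and \<open>t1\<close> are the only indices \<open>t\<close>
    that survive, without and with \<open>u\<close>: the index sums of the remaining factors. With
    \<open>u\<close> these start from \<open>(j, i)\<close>, since the leading \<open>u\<close>
    exchanges the coordinates.\<close>
  define t0 where "t0 = (Suc n * i mod N, Suc n * j mod N)"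
  define A where "A = twist_sum (Suc n) (j, i)"
  define t1 where "t1 = (fst A mod N, snd A mod N)"
  define E where "E = twist_exponent (Suc n) (j, i)"
  have t: "t0 \<in> ?R" "t1 \<in> ?R"
    using N by (auto simp: t0_def t1_def residue_pairs_def)
  have P0: "?P 0 t = (if t = t0 then if b = 0 then 1 else 0 else 0)" for t
    using Suc.prems by (subst Suc.IH) (auto simp: basis_vec_def t0_def s)
  have P1: "?P (Suc 0) t = (if t = t1 then if b = Suc (Suc n) mod 2 then \<xi> ^ E else 0 else 0)" for t
  proof -
    have "Suc b mod 2 = Suc n mod 2 \<longleftrightarrow> b = Suc (Suc n) mod 2"
      using \<open>b < 2\<close> by (auto simp: less_2_cases_iff mod_Suc split: if_splits)
    then show ?thesis
      using Suc.prems
      by (subst Suc.IH) (auto simp: basis_vec_def residue_pairs_def t1_def s A_def E_def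
          simp del: twist_sum.simps twist_exponent.simps)
  qed
  have "sweedler_power ?H (Suc (Suc n)) x (s, b) =
      (\<Sum>t\<in>?R. x (add_mod N s t, 0) * masuoka_tau \<xi> s t 0 * ?P 0 t) +
      (\<Sum>t\<in>?R. x (add_mod N s t, 1) * masuoka_tau \<xi> s t 1 *
        masuoka_sigma \<xi> s 1 (Suc b mod 2) * ?P (Suc 0) t)"
    using Suc.prems by (simp add: sweedler_power_masuoka_Suc sum_lessThan_2)
  also have "(\<Sum>t\<in>?R. x (add_mod N s t, 0) * masuoka_tau \<xi> s t 0 * ?P 0 t) =
      (\<Sum>t\<in>?R. if t = t0 then if b = 0 then x (add_mod N s t, 0) else 0 else 0)"
    by (intro sum.cong refl) (simp only: P0, simp add: masuoka_tau_def)
  also have "\<dots> = (if b = 0 then x (add_mod N s t0, 0) else 0)"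
    using t by simp
  also have "add_mod N s t0 = (Suc (Suc n) * fst s mod N, Suc (Suc n) * snd s mod N)"
    by (simp add: add_mod_def s t0_def mod_simps)
  also have "(\<Sum>t\<in>?R. x (add_mod N s t, 1) * masuoka_tau \<xi> s t 1 *
        masuoka_sigma \<xi> s 1 (Suc b mod 2) * ?P (Suc 0) t) =
      (\<Sum>t\<in>?R. if t = t1 then if b = Suc (Suc n) mod 2 then x (add_mod N s t, 1) *
        masuoka_tau \<xi> s t 1 * masuoka_sigma \<xi> s 1 (Suc b mod 2) * \<xi> ^ E else 0 else 0)"
    by (intro sum.cong refl) (simp only: P1, simp)
  also have "\<dots> = (if b = Suc (Suc n) mod 2 then x (add_mod N s t1, 1) *
        masuoka_tau \<xi> s t1 1 * masuoka_sigma \<xi> s 1 (Suc b mod 2) * \<xi> ^ E else 0)"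
    using t by simp
  also have "add_mod N s t1 = (fst (twist_sum (Suc (Suc n)) s) mod N, snd (twist_sum (Suc (Suc n)) s) mod N)"
    unfolding twist_sum.simps(2)[of "Suc n"]
    by (simp add: add_mod_def s t1_def A_def mod_simps del: twist_sum.simps)
  also have "(if b = Suc (Suc n) mod 2 then
      x ((fst (twist_sum (Suc (Suc n)) s) mod N, snd (twist_sum (Suc (Suc n)) s) mod N), 1) *
        masuoka_tau \<xi> s t1 1 * masuoka_sigma \<xi> s 1 (Suc b mod 2) * \<xi> ^ E else 0) =
      (if b = Suc (Suc n) mod 2 then \<xi> ^ twist_exponent (Suc (Suc n)) s *
      x ((fst (twist_sum (Suc (Suc n)) s) mod N, snd (twist_sum (Suc (Suc n)) s) mod N), 1) else 0)"
  proof (rule if_cong[OF refl _ refl])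
    assume b: "b = Suc (Suc n) mod 2"
    have "masuoka_tau \<xi> s t1 1 = \<xi> ^ (j * (fst A mod N))"
      by (simp add: masuoka_tau_def s t1_def)
    also have "\<dots> = \<xi> ^ (j * fst A)"
      by (intro root_of_unity_power_cong[OF xi]) (simp add: cong_def mod_simps)
    finally have tau: "masuoka_tau \<xi> s t1 1 = \<xi> ^ (j * fst A)" .
    have "Suc b mod 2 = Suc n mod 2"
      unfolding b by (simp add: mod_Suc)
    then have sigma: "masuoka_sigma \<xi> s 1 (Suc b mod 2) = \<xi> ^ (if odd (Suc n) then i * j else 0)"
      by (simp add: masuoka_sigma_def s mod_Suc odd_iff_mod_2_eq_one)
    have "twist_exponent (Suc (Suc n)) s = j * fst A + E + (if odd (Suc n) then i * j else 0)"
      unfolding twist_exponent.simps(2)[of "Suc n"] by (simp only: s A_def E_def fst_conv snd_conv)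
    then show "x ((fst (twist_sum (Suc (Suc n)) s) mod N, snd (twist_sum (Suc (Suc n)) s) mod N), 1) *
        masuoka_tau \<xi> s t1 1 * masuoka_sigma \<xi> s 1 (Suc b mod 2) * \<xi> ^ E =
      \<xi> ^ twist_exponent (Suc (Suc n)) s *
      x ((fst (twist_sum (Suc (Suc n)) s) mod N, snd (twist_sum (Suc (Suc n)) s) mod N), 1)"
      by (simp only: tau sigma power_add mult_ac)
  qed
  finally show ?case .
qed

section \<open>The integral and the indicator as a quadratic sum\<close>

lemma mul_masuoka:
  assumes "r \<in> residue_pairs N" "c < 2"
  shows "mul (masuoka_hopf N \<xi>) x y (r, c) =
    (\<Sum>a<2. x (r, a) * y (swap_act r a, (a + c) mod 2) * masuoka_sigma \<xi> r a ((a + c) mod 2))"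
proof -
  let ?H = "masuoka_hopf N \<xi>"
  have "mul ?H x y (r, c) = (\<Sum>p\<in>basis ?H. x p * mul ?H (basis_vec p) y (r, c))"
    by (rule mul_expand_left) (simp add: basis_masuoka)
  also have "\<dots> = (\<Sum>s\<in>residue_pairs N. \<Sum>a<2. x (s, a) * mul ?H (basis_vec (s, a)) y (r, c))"
    by (simp add: basis_masuoka sum.cartesian_product')
  also have "\<dots> = (\<Sum>s\<in>residue_pairs N. if s = r then \<Sum>a<2.
      x (r, a) * y (swap_act r a, (a + c) mod 2) * masuoka_sigma \<xi> r a ((a + c) mod 2) else 0)"
    using assms by (intro sum.cong refl) (auto simp: mul_masuoka_basis_vec intro!: sum.cong)
  finally show ?thesis
    using assms by simp
qed

text \<open>\<open>is_integral\<close> compares functions on the whole type, so products are also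
  needed at arguments outside the basis.\<close>

lemma mul_masuoka_outside:
  assumes "p \<notin> basis (masuoka_hopf N \<xi>)"
  shows "mul (masuoka_hopf N \<xi>) x y p = 0"
  using assms unfolding mul_def
  by (intro sum.neutral ballI) (cases p, auto simp: masuoka_hopf_def split: if_splits)

lemma counit_masuoka:
  assumes "N > 0"
  shows "counit (masuoka_hopf N \<xi>) x = x ((0, 0), 0) + x ((0, 0), 1)"
proof -
  have "counit (masuoka_hopf N \<xi>) x =
      (\<Sum>s\<in>residue_pairs N. if s = (0, 0) then \<Sum>a<2. x (s, a) else 0)"
    unfolding counit_def basis_masuoka sum.cartesian_product'
    by (intro sum.cong refl) (simp add: masuoka_hopf_def)
  then show ?thesis
    using assms by (simp add: residue_pairs_def sum_lessThan_2)
qed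

text \<open>A summand with \<open>u\<close> changes the parity of the power of \<open>u\<close> and
  has no diagonal entries; the coefficient at \<open>(s, 0)\<close> occurs once for each of the two
  powers of \<open>u\<close>.\<close>

lemma regular_character_masuoka:
  "regular_character (masuoka_hopf N \<xi>) x = 2 * (\<Sum>s\<in>residue_pairs N. x (s, 0))"
proof -
  let ?H = "masuoka_hopf N \<xi>"
  have "mul ?H x (basis_vec p) p = x (fst p, 0)" if "p \<in> basis ?H" for p
    using that by (cases p) (auto simp: basis_masuoka mul_masuoka sum_lessThan_2 basis_vec_def less_2_cases_iff)
  then have "regular_character ?H x = (\<Sum>p\<in>residue_pairs N \<times> {..<2::nat}. x (fst p, 0))"
    by (simp add: regular_character_def basis_masuoka)
  then show ?thesis
    by (simp add: sum.cartesian_product' sum_distrib_left)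
qed

lemma normalized_integral_masuoka:
  assumes "N > 0"
  shows "normalized_integral (masuoka_hopf N \<xi>) =
    (\<lambda>p. if p = ((0, 0), 0) \<or> p = ((0, 0), 1) then 1 / 2 else 0)"
    (is "_ = ?L")
proof (rule normalized_integral_eqI)
  let ?H = "masuoka_hopf N \<xi>"
  show "counit ?H ?L = 1"
    using assms by (simp add: counit_masuoka)
  have elem: "?L \<in> elements ?H"
    using assms by (auto simp: elements_def basis_masuoka residue_pairs_def)
  \<comment> \<open>At index \<open>(0, 0)\<close> the exchange and the cocycle are both trivial, so
    \<open>?L\<close> behaves like the integral of the group algebra of order 2.\<close>
  have sigma: "masuoka_sigma \<xi> (0, 0) a b = 1" for a b
    by (simp add: masuoka_sigma_def)
  have "mul ?H h ?L p = counit ?H h * ?L p \<and> mul ?H ?L h p = counit ?H h * ?L p" for h p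
  proof (cases "p \<in> basis ?H")
    case False
    then have "?L p = 0"
      using elem unfolding elements_def by blast
    then show ?thesis
      by (simp only: mul_masuoka_outside[OF False] mult_zero_right)
  next
    case True
    then obtain i j c where p: "p = ((i, j), c)" "(i, j) \<in> residue_pairs N" "c < 2"
      by (auto simp: basis_masuoka)
    then show ?thesis
      using assms
      by (auto simp: mul_masuoka counit_masuoka sum_lessThan_2 sigma less_2_cases_iff field_simps)
  qed
  then show "is_integral ?H ?L"
    using elem by (auto simp: is_integral_def)
qed

text \<open>These are the residues annihilated by \<open>m\<close>. Cancelling
  \<open>gcd N m\<close> leaves coprime cofactors, so the condition says that
  \<open>N div gcd N m\<close> divides \<open>t\<close>.\<close>

lemma dvd_mult_residues_eq:
  fixes N m :: nat
  assumes "N > 0"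
  shows "{t. t < N \<and> N dvd m * t} = (\<lambda>k. N div gcd N m * k) ` {..<gcd N m}"
proof -
  define d where "d = gcd N m"
  define N' where "N' = N div d"
  define m' where "m' = m div d"
  have d: "d > 0" and N: "N = d * N'" and m: "m = d * m'"
    using assms by (auto simp: d_def N'_def m'_def)
  have cop: "coprime N' m'"
    using assms by (simp add: N'_def m'_def d_def div_gcd_coprime)
  have "N' > 0"
    using N assms by (cases N') auto
  have "N dvd m * t \<longleftrightarrow> N' dvd t" for t
  proof -
    have "N dvd m * t \<longleftrightarrow> N' dvd m' * t"
      using d unfolding N m by (simp add: mult.assoc)
    then show ?thesis
      using cop by (simp add: coprime_dvd_mult_right_iff)
  qed
  then have "{t. t < N \<and> N dvd m * t} = (\<lambda>k. N' * k) ` {..<d}"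
    using \<open>N' > 0\<close> by (auto simp: N mult.commute elim!: dvdE)
  then show ?thesis
    by (simp add: N'_def d_def)
qed

lemma sum_dvd_mult_residues:
  fixes N m :: nat
  assumes "N > 0"
  shows "(\<Sum>t<N. if N dvd m * t then f t else 0) = (\<Sum>k<gcd N m. f (N div gcd N m * k))"
proof -
  have "inj_on (\<lambda>k. N div gcd N m * k) {..<gcd N m}"
    using assms by (auto simp: inj_on_def dvd_div_eq_0_iff)
  moreover have "(\<Sum>t<N. if N dvd m * t then f t else 0) = sum f {t. t < N \<and> N dvd m * t}"
    by (simp add: sum.If_cases lessThan_def Int_def)
  ultimately show ?thesis
    using assms by (simp add: dvd_mult_residues_eq sum.reindex)
qed

text \<open>For each of the \<open>N\<close> values of the first coordinate, translation by it
  permutes the residues.\<close>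

lemma sum_residue_pairs_add_mod:
  fixes f :: "nat \<Rightarrow> complex"
  assumes "N > 0"
  shows "(\<Sum>s\<in>residue_pairs N. f ((fst s + snd s) mod N)) = of_nat N * (\<Sum>t<N. f t)"
proof -
  have "(\<Sum>j<N. f ((i + j) mod N)) = (\<Sum>t<N. f t)" for i
  proof (rule sum.reindex_bij_betw)
    have "inj_on (\<lambda>j. (i + j) mod N) {..<N}"
      by (rule inj_onI) (metis cong_def cong_add_lcancel_nat lessThan_iff mod_less)
    moreover have "(\<lambda>j. (i + j) mod N) ` {..<N} \<subseteq> {..<N}"
      using assms by auto
    ultimately show "bij_betw (\<lambda>j. (i + j) mod N) {..<N} {..<N}"
      by (simp add: bij_betw_def endo_inj_surj)
  qed
  then show ?thesis
    by (simp add: residue_pairs_def sum.cartesian_product')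
qed

lemma fs_indicator_masuoka:
  assumes "N > 0" "\<xi> ^ N = 1" "n > 0"
  shows "fs_indicator n (masuoka_hopf N \<xi>) = of_nat ((gcd N n)\<^sup>2) +
    (if even n then of_nat N * (\<Sum>k<gcd N (n div 2).
       \<xi> ^ (((n div 2) choose 2) * (N div gcd N (n div 2) * k)\<^sup>2)) else 0)"
proof -
  let ?H = "masuoka_hopf N \<xi>"
  let ?R = "residue_pairs N"
  obtain n' where n': "n = Suc n'"
    using assms(3) gr0_implies_Suc by blast
  define m where "m = n div 2"
  \<comment> \<open>\<open>g\<close> and \<open>h\<close> are the contributions of the two halves of
    the integral; its factor \<open>1 / 2\<close> cancels the 2 of the regular character.
    \<open>g\<close> is a product over the coordinates, and \<open>h\<close> depends only on their
    sum modulo \<open>N\<close>, through \<open>f\<close>.\<close>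
  define f where "f t = (if N dvd m * t then \<xi> ^ ((m choose 2) * t\<^sup>2) else 0)" for t
  define g :: "nat \<times> nat \<Rightarrow> complex" where
    "g s = (if N dvd n * fst s then 1 else 0) * (if N dvd n * snd s then 1 else 0)" for s
  define h where "h s = (if even n then f ((fst s + snd s) mod N) else 0)" for s :: "nat \<times> nat"
  have terms: "2 * sweedler_power ?H n (normalized_integral ?H) (s, 0) = g s + h s"
    if s: "s \<in> ?R" for s
  proof -
    obtain i j where ij: "s = (i, j)" by (cases s)
    have E: "twist_exponent n s = (m choose 2) * (i + j)\<^sup>2 + m * (i + j) * j"
      and A: "twist_sum n s = (m * (i + j), m * (i + j))" if "even n"
      using that twist_exponent_even[of m i j] twist_sum_even[of m i j] by (simp_all add: m_def ij)
    have "f ((i + j) mod N) = (if N dvd m * (i + j) then \<xi> ^ twist_exponent n s else 0)" if "even n"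
    proof -
      have "N dvd m * ((i + j) mod N) \<longleftrightarrow> N dvd m * (i + j)"
        by (simp add: dvd_eq_mod_eq_0 mod_simps)
      moreover have "\<xi> ^ ((m choose 2) * ((i + j) mod N)\<^sup>2) = \<xi> ^ twist_exponent n s"
        if "N dvd m * (i + j)"
      proof (rule root_of_unity_power_cong[OF assms(2)])
        \<comment> \<open>The summand \<open>0\<close> is matched with
          \<open>m * (i + j) * j\<close>, which is divisible by \<open>N\<close> here.\<close>
        have "[(m choose 2) * ((i + j) mod N)\<^sup>2 + 0 = (m choose 2) * (i + j)\<^sup>2 + m * (i + j) * j] (mod N)"
          using that
          by (intro cong_add cong_mult cong_pow) (auto simp: cong_def intro!: dvd_imp_mod_0[symmetric])
        then show "[(m choose 2) * ((i + j) mod N)\<^sup>2 = twist_exponent n s] (mod N)"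
          using E \<open>even n\<close> by simp
      qed
      ultimately show ?thesis
        by (simp add: f_def)
    qed
    moreover have "2 * sweedler_power ?H n (normalized_integral ?H) (s, 0) =
        (if N dvd n * i \<and> N dvd n * j then 1 else 0) +
        (if even n then if N dvd fst (twist_sum n s) \<and> N dvd snd (twist_sum n s)
          then \<xi> ^ twist_exponent n s else 0 else 0)"
    proof -
      have L: "normalized_integral ?H ((a, b), c) = (if a = 0 \<and> b = 0 then 1 / 2 else 0)"
        if "c < 2" for a b c
        using that assms(1) by (auto simp: normalized_integral_masuoka)
      have "sweedler_power ?H n (normalized_integral ?H) (s, 0) =
          normalized_integral ?H ((n * i mod N, n * j mod N), 0) +
          (if even n then \<xi> ^ twist_exponent n s *
            normalized_integral ?H ((fst (twist_sum n s) mod N, snd (twist_sum n s) mod N), 1) else 0)"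
        using sweedler_power_masuoka[OF assms(2) s, of 0 n' "normalized_integral ?H"]
        unfolding n'[symmetric] by (simp add: ij even_iff_mod_2_eq_zero eq_commute[of 0])
      then show ?thesis
        by (simp add: L mod_eq_0_iff_dvd)
    qed
    ultimately show ?thesis
      using A by (auto simp: g_def h_def ij)
  qed
  have "fs_indicator n ?H = (\<Sum>s\<in>?R. g s + h s)"
    unfolding fs_indicator_def regular_character_masuoka sum_distrib_left
    by (intro sum.cong refl terms)
  also have "\<dots> = (\<Sum>s\<in>?R. g s) + (\<Sum>s\<in>?R. h s)"
    by (rule sum.distrib)
  also have "(\<Sum>s\<in>?R. g s) = (\<Sum>i<N. if N dvd n * i then 1 else 0)\<^sup>2"
    by (simp add: g_def residue_pairs_def sum.cartesian_product' power2_eq_square sum_product)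
  also have "(\<Sum>i<N. if N dvd n * i then 1 else 0) = (of_nat (gcd N n) :: complex)"
    using sum_dvd_mult_residues[OF assms(1), of n "\<lambda>_. 1 :: complex"] by simp
  also have "(\<Sum>s\<in>?R. h s) = (if even n then of_nat N * (\<Sum>t<N. f t) else 0)"
    using sum_residue_pairs_add_mod[OF assms(1), of f] by (simp add: h_def)
  also have "(\<Sum>t<N. f t) = (\<Sum>k<gcd N m. \<xi> ^ ((m choose 2) * (N div gcd N m * k)\<^sup>2))"
    unfolding f_def using assms(1) by (rule sum_dvd_mult_residues)
  finally show ?thesis
    by (simp add: m_def)
qed

section \<open>Evaluation of the quadratic sum\<close>

text \<open>The exponent \<open>N\<close> guarantees that the \<open>LEAST\<close> in
  \<open>mult_order\<close> is attained; minimality then forces the remainder of \<open>k\<close> to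
  be 0.\<close>

lemma power_eq_1_iff_mult_order_dvd:
  fixes \<xi> :: complex
  assumes "N > 0" "\<xi> ^ N = 1"
  shows "\<xi> ^ k = 1 \<longleftrightarrow> mult_order \<xi> dvd k"
proof -
  define d where "d = mult_order \<xi>"
  have d: "d > 0 \<and> \<xi> ^ d = 1"
    using LeastI[of "\<lambda>d. d > 0 \<and> \<xi> ^ d = 1" N] assms by (simp add: d_def mult_order_def)
  have least: "d \<le> e" if "e > 0" "\<xi> ^ e = 1" for e
    unfolding d_def mult_order_def using that by (simp add: Least_le)
  have "\<xi> ^ k = \<xi> ^ (k mod d)"
    using d by (simp add: root_of_unity_power_mod)
  moreover have "\<xi> ^ (k mod d) = 1 \<longleftrightarrow> k mod d = 0"
    using d least[of "k mod d"] mod_less_divisor[of d k] by (metis leD neq0_conv power_0)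
  ultimately show ?thesis
    by (simp add: d_def mod_eq_0_iff_dvd)
qed

text \<open>The order \<open>d\<close> divides \<open>N\<close>, and it divides
  \<open>N div 2\<close> exactly when the quotient \<open>N div d\<close> is even, that is, when
  \<open>d\<close> has smaller 2-adic valuation than \<open>N\<close>.\<close>

lemma power_half_eq_1_iff:
  fixes \<xi> :: complex
  assumes "N > 0" "\<xi> ^ N = 1" "even N"
  shows "\<xi> ^ (N div 2) = 1 \<longleftrightarrow> multiplicity 2 (mult_order \<xi>) \<noteq> multiplicity 2 N"
proof -
  define d where "d = mult_order \<xi>"
  obtain h where h: "N = 2 * h" "h > 0"
    using assms by (auto elim!: evenE)
  have multN: "multiplicity 2 N = Suc (multiplicity 2 h)"
    using h by (simp add: multiplicity_times_same)
  obtain q where q: "N = d * q"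
    using power_eq_1_iff_mult_order_dvd[OF assms(1,2), of N] assms(2) by (auto simp: d_def elim!: dvdE)
  have dq: "d > 0" "q > 0"
    using q assms(1) by (auto intro!: Nat.gr0I)
  have "d dvd h \<longleftrightarrow> multiplicity 2 d \<noteq> multiplicity 2 N"
  proof
    assume "d dvd h"
    then have "multiplicity 2 d \<le> multiplicity 2 h"
      using h by (intro dvd_imp_multiplicity_le) auto
    then show "multiplicity 2 d \<noteq> multiplicity 2 N"
      using multN by simp
  next
    assume ne: "multiplicity 2 d \<noteq> multiplicity 2 N"
    have "multiplicity 2 N = multiplicity 2 d + multiplicity 2 q"
      unfolding q using dq by (intro prime_elem_multiplicity_mult_distrib) auto
    with ne have "even q"
      using not_dvd_imp_multiplicity_0[of 2 q] by fastforce
    then show "d dvd h"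
      using q h by (auto elim!: evenE)
  qed
  then show ?thesis
    using power_eq_1_iff_mult_order_dvd[OF assms(1,2), of h] h by (simp add: d_def)
qed

text \<open>The cofactors are coprime, so at least one is odd; the valuations of \<open>N\<close>
  and \<open>m\<close> differ by the valuation of the other.\<close>

lemma multiplicity_eq_iff_odd_cofactors:
  fixes N m :: nat
  assumes "N > 0" "m > 0"
  shows "multiplicity 2 N = multiplicity 2 m \<longleftrightarrow> odd (N div gcd N m * (m div gcd N m))"
proof -
  define d N' m' where "d = gcd N m" and "N' = N div d" and "m' = m div d"
  have N: "N = d * N'" and m: "m = d * m'"
    by (auto simp: d_def N'_def m'_def)
  have pos: "d > 0" "N' > 0" "m' > 0"
    using N m assms by (auto intro!: Nat.gr0I)
  have "coprime N' m'"
    using assms by (simp add: N'_def m'_def d_def div_gcd_coprime)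
  then have cop: "odd N' \<or> odd m'"
    using coprime_common_divisor_nat[of N' m' 2] by auto
  have "multiplicity 2 N = multiplicity 2 d + multiplicity 2 N'"
    "multiplicity 2 m = multiplicity 2 d + multiplicity 2 m'"
    unfolding N m using pos by (auto intro!: prime_elem_multiplicity_mult_distrib)
  moreover have "multiplicity 2 N' = 0 \<longleftrightarrow> odd N'" "multiplicity 2 m' = 0 \<longleftrightarrow> odd m'"
    using pos by (auto simp: multiplicity_eq_zero_iff)
  ultimately have "multiplicity 2 N = multiplicity 2 m \<longleftrightarrow> odd (N' * m')"
    using cop by (metis add_left_cancel even_mult_iff)
  then show ?thesis
    by (simp add: N'_def m'_def d_def)
qed

lemma sum_alternating_even:
  "(\<Sum>k<2 * e. (- 1 :: complex) ^ k) = 0"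
  by (induction e) auto

text \<open>With \<open>N = d * N'\<close> and \<open>m = d * m'\<close>, twice the exponent is
  \<open>N * m' * (m - 1) * N' * k\<^sup>2\<close>. If \<open>m - 1\<close>, \<open>m'\<close> or
  \<open>N'\<close> is even, the exponent is a multiple of \<open>N\<close> and every term is 1.
  Otherwise it is an odd multiple of \<open>(N div 2) * k\<^sup>2\<close>, and
  \<open>k\<^sup>2\<close> has the parity of \<open>k\<close>.\<close>

lemma quadratic_gauss_sum:
  fixes \<xi> :: complex and N m :: nat
  assumes "N > 0" "\<xi> ^ N = 1" "m > 0"
  shows "(\<Sum>k<gcd N m. \<xi> ^ ((m choose 2) * (N div gcd N m * k)\<^sup>2)) =
    (if even m \<and> multiplicity 2 N = multiplicity 2 m \<and>
        multiplicity 2 (mult_order \<xi>) = multiplicity 2 N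
     then 0 else of_nat (gcd N m))"
proof -
  define d N' m' where "d = gcd N m" and "N' = N div d" and "m' = m div d"
  have N: "N = d * N'" and m: "m = d * m'"
    by (auto simp: d_def N'_def m'_def)
  define S where "S = (\<Sum>k<d. \<xi> ^ ((m choose 2) * (N' * k)\<^sup>2))"
  have trivial: "S = of_nat d" if "\<And>k. N dvd (m choose 2) * (N' * k)\<^sup>2"
  proof -
    have "\<xi> ^ ((m choose 2) * (N' * k)\<^sup>2) = 1" for k
      using root_of_unity_power_cong[OF assms(2), of _ 0] that by (simp add: cong_0_iff)
    then show ?thesis
      by (simp add: S_def)
  qed
  have odd_iff: "multiplicity 2 N = multiplicity 2 m \<longleftrightarrow> odd (N' * m')"
    using multiplicity_eq_iff_odd_cofactors[OF assms(1,3)] by (simp add: N'_def m'_def d_def)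
  have choose: "2 * (m choose 2) = m * (m - 1)"
  proof -
    have "even (m * (m - 1))"
      by (cases m) auto
    then show ?thesis
      by (simp only: choose_two dvd_mult_div_cancel)
  qed
  consider "odd m" | "even m" "even (N' * m')" | "even m" "odd (N' * m')"
    by blast
  then have "S = (if even m \<and> multiplicity 2 N = multiplicity 2 m \<and>
        multiplicity 2 (mult_order \<xi>) = multiplicity 2 N then 0 else of_nat d)"
  proof cases
    case 1
    then obtain q where "m - 1 = 2 * q"
      by (auto elim!: oddE)
    then have "(m choose 2) * (N' * k)\<^sup>2 = N * (m' * q * N' * k\<^sup>2)" for k
      using choose by (simp add: m N power2_eq_square)
    then have "S = of_nat d"
      by (intro trivial) simp
    with 1 show ?thesis
      by simp
  next
    case 2
    then obtain q where q: "N' * m' = 2 * q"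
      by (auto elim!: evenE)
    have "2 * ((m choose 2) * (N' * k)\<^sup>2) = 2 * (N * ((m - 1) * q * k\<^sup>2))" for k
    proof -
      have "2 * ((m choose 2) * (N' * k)\<^sup>2) = (2 * (m choose 2)) * (N' * k)\<^sup>2"
        by simp
      also have "\<dots> = d * N' * (m - 1) * (N' * m') * k\<^sup>2"
        unfolding choose by (subst (1) m) (simp add: power2_eq_square mult_ac)
      finally show ?thesis
        by (simp add: q N)
    qed
    then have "S = of_nat d"
      by (intro trivial) simp
    with 2 odd_iff show ?thesis
      by simp
  next
    case 3
    \<comment> \<open>Here \<open>m\<close> is even and \<open>m'\<close> odd, so \<open>d\<close>
      is even; hence alternating signs cancel in pairs.\<close>
    then obtain e where e: "d = 2 * e"
      using m by (auto elim!: evenE)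
    define \<eta> where "\<eta> = \<xi> ^ (e * N')"
    have half: "N div 2 = e * N'" and evenN: "even N"
      by (simp_all add: N e)
    have "\<eta>\<^sup>2 = 1"
      using assms(2) by (simp add: \<eta>_def N e mult_ac flip: power_mult)
    then have eta: "\<eta> = 1 \<or> \<eta> = - 1"
      by (simp add: power2_eq_1_iff)
    have "m choose 2 = e * m' * (m - 1)"
      using choose m e by simp
    then have "\<xi> ^ ((m choose 2) * (N' * k)\<^sup>2) = \<eta> ^ (m' * (m - 1) * N' * k\<^sup>2)" for k
      by (simp add: \<eta>_def power2_eq_square mult_ac flip: power_mult)
    moreover have "even (m' * (m - 1) * N' * k\<^sup>2) \<longleftrightarrow> even k" for k
      using 3 assms(3) by auto
    ultimately have pow: "\<xi> ^ ((m choose 2) * (N' * k)\<^sup>2) = \<eta> ^ k" for k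
      using eta by (auto simp: minus_one_power_iff)
    show ?thesis
    proof (cases "\<eta> = 1")
      case True
      then have "S = of_nat d"
        by (simp add: S_def pow)
      with True show ?thesis
        using power_half_eq_1_iff[OF assms(1,2) evenN] half by (simp add: \<eta>_def)
    next
      case False
      then have "S = 0"
        using eta by (simp add: S_def pow e sum_alternating_even)
      with False show ?thesis
        using power_half_eq_1_iff[OF assms(1,2) evenN] half 3 odd_iff by (simp add: \<eta>_def)
    qed
  qed
  then show ?thesis
    by (simp add: S_def d_def N'_def)
qed

theorem theorem5p1:
  fixes N n :: nat and \<xi> :: complex
  assumes "N > 1" and "\<xi> ^ N = 1" and "n \<ge> 1"
  shows "fs_indicator n (masuoka_hopf N \<xi>) =
    (if odd n \<or>
        (multiplicity 2 N = multiplicity 2 (mult_order \<xi>) \<and>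
         int (multiplicity 2 (mult_order \<xi>)) = int (multiplicity 2 n) - 1 \<and>
         int (multiplicity 2 n) - 1 \<ge> 1)
     then of_nat ((gcd N n)\<^sup>2)
     else of_nat ((gcd N n)\<^sup>2 + N * gcd N (n div 2)))"
proof (cases "odd n")
  case True
  then show ?thesis
    using assms by (simp add: fs_indicator_masuoka)
next
  case False
  then obtain m where n: "n = 2 * m" and m: "m > 0"
    using assms(3) by (auto elim!: evenE)
  \<comment> \<open>Since \<open>multiplicity 2 n - 1\<close> is the valuation of \<open>m\<close>,
    the bound \<open>\<ge> 1\<close> says that \<open>m\<close> is even, and the exceptional
    condition is the one under which the quadratic sum vanishes.\<close>
  have mult_n: "multiplicity 2 n = Suc (multiplicity 2 m)"
    using m by (simp add: n multiplicity_times_same)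
  have mult_m: "multiplicity 2 m \<ge> 1 \<longleftrightarrow> even m"
    using m multiplicity_eq_zero_iff[of m 2] by auto
  show ?thesis
    using assms m mult_m fs_indicator_masuoka[of N \<xi> n] quadratic_gauss_sum[of N \<xi> m]
    by (auto simp: mult_n) (auto simp: n)
qed

end
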